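(* Let $\Omega=D(0,1)\subset\mathbb{R}^2$ be the open unit disc and let $B:\Omega\to\mathbb{R}$ be a locally Lipschitz radial magnetic field (i.e. $B(q)$ depends only on $\|q\|$). Assume that $$\limsup_{r\to1^-}\left|\int_{D(0,r)}B(q)\,\mathrm{d}q\right|<+\infty,$$ where $D(0,r)$ is the open disc of radius $r$ centered at the origin. Then there exists a trajectory of the magnetic equations of motion with field $B$ that starts in $\Omega$ and reaches the boundary $\partial\Omega$ in finite time.
   Context: The particle has unit charge and mass and moves in the disc according to Newton's equation $\ddot q=B(q)\,(\dot q_2,-\dot q_1)$, where $q=(q_1,q_2)$. Equivalently, it follows the Hamiltonian flow of $\mathcal{H}(q,p)=\frac12\|p-\mathbf{A}(q)\|^2$ with $p=\dot q+\mathbf{A}(q)$, where $\mathbf{A}$ is a vector potential satisfying $\partial_{q_1}A_2-\partial_{q_2}A_1=B$. A trajectory "reaches the boundary in finite time" if there is a finite $T>0$ such that the solution is defined in $\Omega$ on $[0,T)$ and $\|q(t)\|\to1$ as $t\to T^-$. *)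

theory Defs
  imports "HOL-Analysis.Analysis"
begin

definition unit_disc :: "(real^2) set" where
  "unit_disc = ball 0 1"

definition radial_on :: "(real^2) set \<Rightarrow> (real^2 \<Rightarrow> real) \<Rightarrow> bool" where
  "radial_on S B \<longleftrightarrow> (\<forall>x\<in>S. \<forall>y\<in>S. norm x = norm y \<longrightarrow> B x = B y)"

text \<open>
  Newton's equation with unit charge and mass, for a curve in the disc. Derivatives are taken
  within the time interval, so they are one-sided at an endpoint that belongs to it.
\<close>
definition magnetic_trajectory :: "(real^2 \<Rightarrow> real) \<Rightarrow> real set \<Rightarrow> (real \<Rightarrow> real^2) \<Rightarrow> bool" where
  "magnetic_trajectory B I q \<longleftrightarrow>
     (\<forall>t\<in>I. q t \<in> unit_disc) \<and>
     (\<exists>v :: real \<Rightarrow> real^2. \<forall>t\<in>I.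
        (q has_vector_derivative v t) (at t within I) \<and>
        (v has_vector_derivative (B (q t) *\<^sub>R vector [v t $ 2, - (v t $ 1)])) (at t within I))"

definition reaches_boundary_at :: "(real^2 \<Rightarrow> real) \<Rightarrow> (real \<Rightarrow> real^2) \<Rightarrow> real \<Rightarrow> bool" where
  "reaches_boundary_at B q T \<longleftrightarrow>
     T > 0 \<and> magnetic_trajectory B {0..<T} q \<and> ((\<lambda>t. norm (q t)) \<longlongrightarrow> 1) (at_left T)"

end

theory Submission
  imports Defs
begin

text \<open>
  Write \<open>F r\<close> for the flux through \<open>D(0,r)\<close>. Along a trajectory \<open>r\<^sup>2 \<theta>' + F r / (2 \<pi>)\<close> is conserved;
  we look for one on which it vanishes, so that the tangential speed is \<open>h r = - F r / (2 \<pi> r)\<close>.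
  The flux is bounded by some \<open>C\<close> near the boundary, hence at energy \<open>r'\<^sup>2 + (h r)\<^sup>2 = C\<^sup>2 + 1\<close>
  a trajectory started there has \<open>r' \<ge> 1\<close> and leaves the disc in finite time. It is obtained by quadrature:
  first \<open>r\<close> from \<open>r' = g r\<close> with \<open>g = sqrt (C\<^sup>2 + 1 - h\<^sup>2)\<close>, then \<open>\<theta>\<close> as a function of \<open>r\<close>
  from \<open>d\<theta>/dr = h r / (r g r)\<close>.
\<close>

section \<open>The flux as a function of the radius\<close>

lemma set_integrable_ball_continuous:
  fixes B :: "real^2 \<Rightarrow> real"
  assumes "continuous_on (ball 0 R) B" "r < R"
  shows "set_integrable lborel (ball 0 r) B"
proof -
  \<comment> \<open>\<open>B\<close> may be unbounded near radius \<open>R\<close>; the strict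
    \<open>r < R\<close> leaves a compact ball on which it is bounded.\<close>
  have "set_integrable lborel (cball 0 r) B"
    using assms by (intro borel_integrable_compact[folded set_integrable_def]
        continuous_on_subset[OF assms(1)] compact_cball) auto
  then show ?thesis
    by (rule set_integrable_subset) auto
qed

lemma measure_ball_real2:
  assumes "0 \<le> r"
  shows "measure lborel (ball (0::real^2) r) = pi * r\<^sup>2"
  using assms by (simp add: content_ball unit_ball_vol_2)

text \<open>The difference is the integral of \<open>B - c\<close> over the annulus between the two
  radii, whose area is \<open>pi * s\<^sup>2 - pi * r\<^sup>2\<close>. Grouped by radius, the terms
  form an increment of flux minus \<open>c\<close> times area, ready for a difference
  quotient.\<close>

lemma flux_annulus_bound:
  fixes B :: "real^2 \<Rightarrow> real"
  assumes cont: "continuous_on (ball 0 R) B"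
    and r: "0 \<le> r" "r \<le> s" "s < R"
    and bound: "\<And>q. r \<le> norm q \<Longrightarrow> norm q < s \<Longrightarrow> \<bar>B q - c\<bar> \<le> e"
  shows "\<bar>((LINT q:ball 0 s|lborel. B q) - c * (pi * s\<^sup>2))
           - ((LINT q:ball 0 r|lborel. B q) - c * (pi * r\<^sup>2))\<bar> \<le> e * (pi * s\<^sup>2 - pi * r\<^sup>2)"
proof -
  define A where "A = ball 0 s - ball (0::real^2) r"
  have [measurable]: "A \<in> sets borel" by (simp add: A_def)
  have un: "ball 0 s = ball (0::real^2) r \<union> A" "ball (0::real^2) r \<inter> A = {}"
    using r by (auto simp: A_def)
  have int_s: "set_integrable lborel (ball 0 s) B"
    using set_integrable_ball_continuous[OF cont] r by simp
  have int_r: "set_integrable lborel (ball 0 r) B"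
    using set_integrable_ball_continuous[OF cont] r by simp
  have int_A: "set_integrable lborel A B"
    using int_s by (rule set_integrable_subset) (auto simp: A_def)
  have meas: "measure lborel A = pi * s\<^sup>2 - pi * r\<^sup>2"
  proof -
    have "measure lborel A = measure lborel (ball (0::real^2) s) - measure lborel (ball (0::real^2) r)"
      unfolding A_def using r emeasure_lborel_ball_finite[of "0::real^2" s]
      by (intro measure_Diff) (auto simp: top.not_eq_extremum)
    then show ?thesis
      using r by (simp add: measure_ball_real2)
  qed
  have fin: "emeasure lborel A < \<infinity>"
    using emeasure_mono[of A "ball 0 s" lborel] emeasure_lborel_ball_finite[of "0::real^2" s]
    by (auto simp: A_def intro: le_less_trans)
  have int_const: "set_integrable lborel A (\<lambda>_. k::real)" for k
    using fin by (simp add: set_integrable_def)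
  have split: "(LINT q:ball 0 s|lborel. B q) = (LINT q:ball 0 r|lborel. B q) + (LINT q:A|lborel. B q)"
    unfolding un(1) by (rule set_integral_Un[OF un(2) int_r int_A])
  have const: "(LINT q:A|lborel. k) = k * (pi * s\<^sup>2 - pi * r\<^sup>2)" for k :: real
    using fin meas by (simp add: set_lebesgue_integral_def)
  have le: "(LINT q:A|lborel. B q) \<le> (LINT q:A|lborel. c + e)"
  proof (rule set_integral_mono[OF int_A int_const])
    fix q assume "q \<in> A"
    then show "B q \<le> c + e" using bound[of q] by (auto simp: A_def)
  qed
  have ge: "(LINT q:A|lborel. c - e) \<le> (LINT q:A|lborel. B q)"
  proof (rule set_integral_mono[OF int_const int_A])
    fix q assume "q \<in> A"
    then show "c - e \<le> B q" using bound[of q] by (auto simp: A_def)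
  qed
  show ?thesis
    using le ge unfolding split const by (simp add: algebra_simps abs_le_iff)
qed

text \<open>A thin annulus at radius \<open>r\<close> has area about \<open>2 * pi * r\<close> times
  its width, and by radiality \<open>B\<close> is close on all of it to its value at a single point
  of the circle. Continuity at that point therefore gives the derivative, without integration in
  polar coordinates.\<close>

lemma flux_has_real_derivative:
  fixes B :: "real^2 \<Rightarrow> real"
  assumes cont: "continuous_on (ball 0 R) B" and rad: "radial_on (ball 0 R) B"
    and r: "0 < r" "r < R"
  shows "((\<lambda>r. LINT q:ball 0 r|lborel. B q) has_real_derivative 2 * pi * r * B (r *\<^sub>R axis 1 1)) (at r)"
proof -
  define F where "F = (\<lambda>r. LINT q:ball 0 r|lborel. B q)"
  define x where "x = r *\<^sub>R (axis 1 1 :: real^2)"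
  \<comment> \<open>Removing the flux of the constant field \<open>B x\<close> reduces the claim to
    a vanishing derivative of \<open>G\<close>.\<close>
  define G where "G = (\<lambda>s. F s - B x * (pi * s\<^sup>2))"
  have nx: "norm x = r" using r by (simp add: x_def)
  have "((\<lambda>s. (G s - G r) / (s - r)) \<longlongrightarrow> 0) (at r)"
  proof (rule LIM_I)
    fix e :: real assume e: "0 < e"
    \<comment> \<open>The difference quotient of \<open>G\<close> will be at most
      \<open>e' * pi * (s + r) \<le> e' * pi * (2 * R)\<close>, which equals
      \<open>e / 2\<close>.\<close>
    define e' where "e' = e / (4 * pi * R)"
    have e': "0 < e'" using e r by (simp add: e'_def)
    have "isCont B x"
      using cont nx r by (simp add: continuous_on_eq_continuous_at)
    then obtain d where d: "d > 0" "\<And>y. dist y x < d \<Longrightarrow> dist (B y) (B x) < e'"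
      using e' unfolding continuous_at_eps_delta by (metis dist_norm)
    define d' where "d' = min d (min r (R - r))"
    have "norm ((G s - G r) / (s - r) - 0) < e" if s: "s \<noteq> r" "norm (s - r) < d'" for s
    proof -
      have sR: "0 < s" "s < R" using s by (auto simp: d'_def)
      have close: "\<bar>B q - B x\<bar> \<le> e'" if q: "\<bar>norm q - r\<bar> < d" "norm q < R" for q
      proof -
        \<comment> \<open>Turning \<open>q\<close> onto the first axis preserves \<open>B\<close>
          and leaves a distance to \<open>x\<close> that depends on the radii alone.\<close>
        define y where "y = norm q *\<^sub>R (axis 1 1 :: real^2)"
        have "q \<in> ball 0 R" "y \<in> ball 0 R" "norm q = norm y"
          using q by (auto simp: y_def)
        then have "B q = B y"
          using rad unfolding radial_on_def by blast
        moreover have "dist y x = \<bar>norm q - r\<bar>"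
          by (simp add: y_def x_def dist_norm flip: scaleR_left_diff_distrib)
        ultimately show ?thesis
          using d(2)[of y] q by (simp add: dist_real_def)
      qed
      have "\<bar>G s - G r\<bar> \<le> e' * (pi * \<bar>s\<^sup>2 - r\<^sup>2\<bar>)"
      proof (cases "r \<le> s")
        case True
        have "\<bar>G s - G r\<bar> \<le> e' * (pi * s\<^sup>2 - pi * r\<^sup>2)"
          unfolding G_def F_def
          using r sR s True close by (intro flux_annulus_bound[OF cont]) (auto simp: d'_def)
        moreover have "r\<^sup>2 \<le> s\<^sup>2" using True r by (simp add: power_mono)
        ultimately show ?thesis by (simp add: algebra_simps)
      next
        case False
        have "\<bar>G r - G s\<bar> \<le> e' * (pi * r\<^sup>2 - pi * s\<^sup>2)"
          unfolding G_def F_def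
          using r sR s False close by (intro flux_annulus_bound[OF cont]) (auto simp: d'_def)
        moreover have "s\<^sup>2 \<le> r\<^sup>2" using False sR by (simp add: power_mono)
        ultimately show ?thesis by (simp add: algebra_simps abs_minus_commute)
      qed
      also have "\<dots> = e' * pi * (s + r) * \<bar>s - r\<bar>"
        using sR r by (simp add: power2_eq_square square_diff_square_factored abs_mult)
      finally have "\<bar>G s - G r\<bar> / \<bar>s - r\<bar> \<le> e' * pi * (s + r)"
        using s by (simp add: divide_le_eq)
      also have "\<dots> \<le> e' * pi * (2 * R)"
        using sR r e' by (intro mult_left_mono) auto
      also have "\<dots> < e" using r e by (simp add: e'_def)
      finally show ?thesis by simp
    qed
    then show "\<exists>d>0. \<forall>s. s \<noteq> r \<and> norm (s - r) < d \<longrightarrow> norm ((G s - G r) / (s - r) - 0) < e"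
      using d(1) r by (intro exI[of _ d']) (auto simp: d'_def)
  qed
  then have "(G has_real_derivative 0) (at r)"
    by (simp add: has_field_derivative_iff)
  then have "((\<lambda>s. G s + B x * (pi * s\<^sup>2)) has_real_derivative 2 * pi * r * B x) (at r)"
    by (auto intro!: derivative_eq_intros)
  then show ?thesis
    by (simp add: G_def F_def x_def)
qed

section \<open>A scalar equation solved by quadrature\<close>

text \<open>The solution is the inverse of the travel time \<open>\<integral> ds / g s\<close>.\<close>
lemma autonomous_ode_reaches_endpoint:
  fixes g :: "real \<Rightarrow> real"
  assumes cont: "\<And>x. a < x \<Longrightarrow> x < b \<Longrightarrow> isCont g x"
    and ge: "\<And>x. a < x \<Longrightarrow> x < b \<Longrightarrow> 1 \<le> g x"
    and ab: "a < b"
  obtains \<rho> T where "0 < T"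
    "\<And>t. 0 \<le> t \<Longrightarrow> t < T \<Longrightarrow> a < \<rho> t \<and> \<rho> t < b \<and> (\<rho> has_real_derivative g (\<rho> t)) (at t)"
    "(\<rho> \<longlongrightarrow> b) (at_left T)"
proof -
  \<comment> \<open>An antiderivative on the open interval is needed, as nothing is known of
    \<open>1 / g\<close> at the endpoints.\<close>
  have "\<exists>F. \<forall>x. ereal a < ereal x \<longrightarrow> ereal x < ereal b \<longrightarrow>
          (F has_vector_derivative 1 / g x) (at x)"
  proof (rule einterval_antiderivative)
    fix x assume "ereal a < ereal x" "ereal x < ereal b"
    then show "isCont (\<lambda>x. 1 / g x) x"
      using cont[of x] ge[of x] by (intro continuous_intros) auto
  qed (use ab in auto)
  then obtain F where F: "\<And>x. a < x \<Longrightarrow> x < b \<Longrightarrow> (F has_real_derivative 1 / g x) (at x)"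
    by (auto simp: has_real_derivative_iff_has_vector_derivative)
  define x0 where "x0 = (a + b) / 2"
  have x0: "a < x0" "x0 < b" using ab by (auto simp: x0_def)
  define \<tau> where "\<tau> = (\<lambda>x. F x - F x0)"
  have D\<tau>: "(\<tau> has_real_derivative 1 / g x) (at x)" if "a < x" "x < b" for x
    unfolding \<tau>_def using F[OF that] by (auto intro!: derivative_eq_intros)
  have mono: "\<tau> x < \<tau> y" if "a < x" "x < y" "y < b" for x y
  proof (rule DERIV_pos_imp_increasing[OF that(2)])
    fix z assume "x \<le> z" "z \<le> y"
    then show "\<exists>d. (\<tau> has_real_derivative d) (at z) \<and> 0 < d"
      using D\<tau>[of z] ge[of z] that by (intro exI[of _ "1 / g z"]) auto
  qed
  have inj: "inj_on \<tau> {a<..<b}"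
    by (rule linorder_inj_onI) (auto dest: mono)
  \<comment> \<open>Since \<open>1 \<le> g\<close>, travel time grows no faster than distance; this
    makes the arrival time \<open>T\<close> finite.\<close>
  have bdd: "\<tau> x \<le> b - x0" if "x0 \<le> x" "x < b" for x
  proof -
    have "\<tau> x - x \<le> \<tau> x0 - x0"
    proof (rule DERIV_nonpos_imp_nonincreasing[OF that(1)])
      fix z assume "x0 \<le> z" "z \<le> x"
      then show "\<exists>d. ((\<lambda>x. \<tau> x - x) has_real_derivative d) (at z) \<and> d \<le> 0"
        using D\<tau>[of z] ge[of z] that x0
        by (intro exI[of _ "1 / g z - 1"]) (auto intro!: derivative_eq_intros)
    qed
    then show ?thesis using that by (simp add: \<tau>_def)
  qed
  define T where "T = Sup (\<tau> ` {x0<..<b})"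
  have bdd_above: "bdd_above (\<tau> ` {x0<..<b})"
    using bdd by (intro bdd_aboveI[of _ "b - x0"]) auto
  have lt_T: "\<tau> x < T" if "x0 \<le> x" "x < b" for x
  proof -
    have "\<tau> x < \<tau> ((x + b) / 2)" using that x0 by (intro mono) auto
    also have "\<dots> \<le> T"
      unfolding T_def using that by (intro cSup_upper bdd_above) auto
    finally show ?thesis .
  qed
  have T: "0 < T" using lt_T[of x0] x0 by (simp add: \<tau>_def)
  \<comment> \<open>The inverse is taken on all of \<open>{a<..<b}\<close> and not only from
    \<open>x0\<close> on, so that \<open>\<rho>\<close> has a two-sided derivative also at time
    \<open>0\<close>, where its value is \<open>x0\<close>.\<close>
  define \<rho> where "\<rho> = the_inv_into {a<..<b} \<tau>"
  have \<rho>\<tau>: "\<rho> (\<tau> x) = x" if "a < x" "x < b" for x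
    unfolding \<rho>_def using that by (intro the_inv_into_f_f inj) auto
  have surj: "\<exists>x. x0 \<le> x \<and> x < b \<and> \<tau> x = t" if t: "0 \<le> t" "t < T" for t
  proof -
    obtain y where y: "x0 < y" "y < b" "t < \<tau> y"
      using t(2) x0 unfolding T_def by (subst (asm) less_cSup_iff[OF _ bdd_above]) auto
    have "\<exists>x. x0 \<le> x \<and> x \<le> y \<and> \<tau> x = t"
    proof (rule IVT)
      show "\<tau> x0 \<le> t" using t by (simp add: \<tau>_def)
      show "\<forall>x. x0 \<le> x \<and> x \<le> y \<longrightarrow> isCont \<tau> x"
        using x0 y by (auto intro!: DERIV_isCont[OF D\<tau>])
    qed (use y in auto)
    with y show ?thesis by force
  qed
  have D\<rho>: "(\<rho> has_real_derivative g x) (at (\<tau> x))" if "a < x" "x < b" for x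
  proof -
    have "(\<rho> has_derivative (*) (g x)) (at (\<tau> x))"
    proof (rule has_derivative_inverse_strong[where S = "{a<..<b}" and f = \<tau> and x = x])
      show "(\<tau> has_derivative (*) (1 / g x)) (at x)"
        using D\<tau>[OF that] by (simp add: has_field_derivative_def)
      show "continuous_on {a<..<b} \<tau>"
        by (auto intro!: continuous_at_imp_continuous_on DERIV_isCont[OF D\<tau>])
      show "(*) (1 / g x) \<circ> (*) (g x) = id"
        using ge[OF that] by auto
    qed (use that \<rho>\<tau> in auto)
    then show ?thesis by (simp add: has_field_derivative_def)
  qed
  have lim: "(\<rho> \<longlongrightarrow> b) (at_left T)"
  proof (rule order_tendstoI)
    \<comment> \<open>At every time in \<open>[0, T)\<close> after \<open>\<tau> y\<close> the
      solution lies beyond \<open>y\<close>, and \<open>\<tau> y < T\<close> leaves a left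
      neighbourhood of such times.\<close>
    have ev: "eventually (\<lambda>t. \<tau> y < t \<and> t < T) (at_left T)" if "x0 \<le> y" "y < b" for y
      using lt_T[OF that] by (auto simp: eventually_at_left_field)
    fix z assume "z < b"
    define y where "y = max z x0"
    have y: "z \<le> y" "x0 \<le> y" "y < b" using x0 \<open>z < b\<close> by (auto simp: y_def)
    from ev[OF y(2,3)] show "eventually (\<lambda>t. z < \<rho> t) (at_left T)"
    proof eventually_elim
      case (elim t)
      have "\<tau> x0 \<le> \<tau> y"
        using mono[of x0 y] x0 y by (cases "x0 = y") auto
      then obtain x where x: "x0 \<le> x" "x < b" "\<tau> x = t"
        using surj[of t] elim by (auto simp: \<tau>_def)
      have "y < x"
        using elim x y x0 mono[of x y] by (cases x y rule: linorder_cases) auto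
      then show ?case using \<rho>\<tau>[of x] x x0 y by auto
    qed
  next
    fix z assume "b < z"
    have "eventually (\<lambda>t. 0 < t \<and> t < T) (at_left T)"
      using T by (auto simp: eventually_at_left_field)
    then show "eventually (\<lambda>t. \<rho> t < z) (at_left T)"
    proof eventually_elim
      case (elim t)
      then obtain x where "x0 \<le> x" "x < b" "\<tau> x = t"
        using surj[of t] by auto
      then show ?case using \<rho>\<tau>[of x] x0 \<open>b < z\<close> by auto
    qed
  qed
  show thesis
  proof (rule that[OF T _ lim])
    fix t assume "0 \<le> t" "t < T"
    then obtain x where "x0 \<le> x" "x < b" "\<tau> x = t" using surj by blast
    then show "a < \<rho> t \<and> \<rho> t < b \<and> (\<rho> has_real_derivative g (\<rho> t)) (at t)"
      using \<rho>\<tau>[of x] D\<rho>[of x] x0 by auto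
  qed
qed

section \<open>Curves in polar coordinates\<close>

lemma has_vector_derivative_vector2:
  fixes f g :: "real \<Rightarrow> real"
  assumes "(f has_real_derivative f') (at t within S)" "(g has_real_derivative g') (at t within S)"
  shows "((\<lambda>t. vector [f t, g t] :: real^2) has_vector_derivative vector [f', g']) (at t within S)"
proof -
  have eq: "vector [x, y] = x *\<^sub>R axis 1 1 + y *\<^sub>R (axis 2 1 :: real^2)" for x y :: real
    by (simp add: vec_eq_iff forall_2 axis_def)
  show ?thesis
    unfolding eq using assms by (auto intro!: derivative_eq_intros)
qed

lemma norm_polar: "norm (vector [r * cos \<theta>, r * sin \<theta>] :: real^2) = \<bar>r\<bar>"
proof -
  have "(r * cos \<theta>)\<^sup>2 + (r * sin \<theta>)\<^sup>2 = r\<^sup>2"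
    by (simp add: power_mult_distrib flip: distrib_left)
  then show ?thesis by (simp add: norm_vec_def L2_set_def sum_2)
qed

section \<open>The escaping trajectory\<close>

theorem proposition2p4:
  fixes B :: "real^2 \<Rightarrow> real"
  assumes "local_lipschitz (UNIV :: real set) unit_disc (\<lambda>_. B)"
    and "radial_on unit_disc B"
    and "Limsup (at_left (1::real)) (\<lambda>r. ereal \<bar>LINT q:ball 0 r|lborel. B q\<bar>) < \<infinity>"
  shows "\<exists>q T. reaches_boundary_at B q T"
proof -
  define F where "F = (\<lambda>r. LINT q:ball 0 r|lborel. B q)"
  define b where "b = (\<lambda>r. B (r *\<^sub>R axis 1 1))"
  have cont: "continuous_on (ball 0 1) B"
    using local_lipschitz_continuous_on[OF assms(1), of 0] by (simp add: unit_disc_def)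
  have DF: "(F has_real_derivative 2 * pi * r * b r) (at r)" if "0 < r" "r < 1" for r
    unfolding F_def b_def using assms(2) that
    by (intro flux_has_real_derivative[OF cont]) (auto simp: unit_disc_def)
  obtain C where C: "Limsup (at_left (1::real)) (\<lambda>r. ereal \<bar>F r\<bar>) < ereal C"
    using assms(3) less_PInf_Ex_of_nat unfolding F_def by (metis ereal_dense2)
  have "eventually (\<lambda>r. \<bar>F r\<bar> < C) (at_left 1)"
    using Limsup_lessD[OF C] by simp
  then obtain a' where a': "a' < 1" "\<And>r. a' < r \<Longrightarrow> r < 1 \<Longrightarrow> \<bar>F r\<bar> < C"
    by (auto simp: eventually_at_left_field)
  \<comment> \<open>The bound \<open>1/2\<close> gives \<open>1 \<le> 2 * pi * r\<close>, hence
    \<open>\<bar>h r\<bar> \<le> \<bar>F r\<bar>\<close>, and keeps the radius away from the polar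
    singularity.\<close>
  define a where "a = max a' (1/2)"
  have a: "a < 1" "1/2 \<le> a" using a' by (auto simp: a_def)
  have F_le: "\<bar>F r\<bar> \<le> C" if "a < r" "r < 1" for r
    using a'(2)[of r] that by (simp add: a_def)
  define h where "h = (\<lambda>r. - F r / (2 * pi * r))"
  \<comment> \<open>The summand \<open>1\<close> keeps the radicand positive, so that
    \<open>g\<close> is differentiable; the positive root makes the motion outward.\<close>
  define g where "g = (\<lambda>r. sqrt (C\<^sup>2 + 1 - (h r)\<^sup>2))"
  have h_le: "(h r)\<^sup>2 \<le> C\<^sup>2" if "a < r" "r < 1" for r
  proof -
    have "1 \<le> 2 * pi * r"
      using pi_ge_two that a mult_mono[of 4 "2 * pi" "1/2" r] by simp
    moreover have "\<bar>h r\<bar> = \<bar>F r\<bar> / (2 * pi * r)"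
      using that a by (simp add: h_def abs_mult)
    ultimately have "\<bar>h r\<bar> \<le> \<bar>F r\<bar>"
      using divide_left_mono[of 1 "2 * pi * r" "\<bar>F r\<bar>"] by simp
    then have "\<bar>h r\<bar> \<le> C" using F_le[OF that] by simp
    then show ?thesis by (metis abs_ge_zero power2_abs power_mono)
  qed
  have g_ge: "1 \<le> g r" if "a < r" "r < 1" for r
    using h_le[OF that] by (simp add: g_def)
  \<comment> \<open>Equivalently, the derivative of \<open>r * h r\<close> is
    \<open>- r * b r\<close>: the flux derivative divided by \<open>- 2 * pi\<close>.\<close>
  have Dh: "(h has_real_derivative - b r - h r / r) (at r)" if "a < r" "r < 1" for r
  proof -
    have "r > 0" using that a by simp
    then show ?thesis
      unfolding h_def
      by (auto intro!: derivative_eq_intros DF that simp: field_simps power2_eq_square)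
  qed
  \<comment> \<open>Differentiating the energy identity
    \<open>(g r)\<^sup>2 + (h r)\<^sup>2 = C\<^sup>2 + 1\<close> gives
    \<open>g * g' = - h * h'\<close>.\<close>
  have Dg: "(g has_real_derivative h r * (b r + h r / r) / g r) (at r)" if "a < r" "r < 1" for r
  proof -
    have pos: "0 < C\<^sup>2 + 1 - (h r)\<^sup>2" using h_le[OF that] by simp
    show ?thesis
      unfolding g_def using pos
      by (auto intro!: derivative_eq_intros Dh that simp: field_simps)
  qed
  obtain \<rho> T where T: "0 < T" and \<rho>:
      "\<And>t. 0 \<le> t \<Longrightarrow> t < T \<Longrightarrow> a < \<rho> t \<and> \<rho> t < 1 \<and> (\<rho> has_real_derivative g (\<rho> t)) (at t)"
    and lim: "(\<rho> \<longlongrightarrow> 1) (at_left T)"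
    by (rule autonomous_ode_reaches_endpoint[of a 1 g]) (use a g_ge in \<open>auto intro: DERIV_isCont[OF Dg]\<close>)
  have "\<exists>\<Theta>. \<forall>x. ereal a < ereal x \<longrightarrow> ereal x < ereal 1 \<longrightarrow>
          (\<Theta> has_vector_derivative h x / (x * g x)) (at x)"
  proof (rule einterval_antiderivative)
    fix x assume "ereal a < ereal x" "ereal x < ereal 1"
    then have x: "a < x" "x < 1" by auto
    then show "isCont (\<lambda>x. h x / (x * g x)) x"
      using DERIV_isCont[OF Dg[OF x]] DERIV_isCont[OF Dh[OF x]] g_ge[OF x] a
      by (intro continuous_intros) auto
  qed (use a in auto)
  then obtain \<Theta> where \<Theta>: "\<And>x. a < x \<Longrightarrow> x < 1 \<Longrightarrow> (\<Theta> has_real_derivative h x / (x * g x)) (at x)"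
    by (auto simp: has_real_derivative_iff_has_vector_derivative)
  define \<theta> where "\<theta> = (\<lambda>t. \<Theta> (\<rho> t))"
  define q :: "real \<Rightarrow> real^2" where
    "q = (\<lambda>t. vector [\<rho> t * cos (\<theta> t), \<rho> t * sin (\<theta> t)])"
  \<comment> \<open>The velocity has component \<open>g\<close> along the radial unit vector
    \<open>(cos \<theta>, sin \<theta>)\<close> and \<open>h\<close> along the tangential one
    \<open>(- sin \<theta>, cos \<theta>)\<close>.\<close>
  define v :: "real \<Rightarrow> real^2" where
    "v = (\<lambda>t. vector [g (\<rho> t) * cos (\<theta> t) - h (\<rho> t) * sin (\<theta> t),
                      g (\<rho> t) * sin (\<theta> t) + h (\<rho> t) * cos (\<theta> t)])"
  have motion: "q t \<in> unit_disc \<and> (q has_vector_derivative v t) (at t within {0..<T}) \<and>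
      (v has_vector_derivative (B (q t) *\<^sub>R vector [v t $ 2, - (v t $ 1)])) (at t within {0..<T})"
    if t: "0 \<le> t" "t < T" for t
  proof -
    define r where "r = \<rho> t"
    have r: "a < r" "r < 1" "r > 0" and D\<rho>: "(\<rho> has_real_derivative g r) (at t)"
      using \<rho>[OF t] a by (auto simp: r_def)
    have gr: "g r > 0" using g_ge[OF r(1,2)] by simp
    \<comment> \<open>The chain rule multiplies the slope of \<open>\<Theta>\<close> by
      \<open>g r\<close>, which cancels and leaves the angular speed.\<close>
    have D\<theta>: "(\<theta> has_real_derivative h r / r) (at t)"
      unfolding \<theta>_def
      using DERIV_chain2[OF \<Theta>[OF r(1,2), unfolded r_def] D\<rho>] gr r
      by (simp add: r_def)
    \<comment> \<open>In the polar frame the pair of components turns clockwise at rate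
      \<open>b r + h r / r\<close>, while the frame turns counterclockwise at rate
      \<open>h r / r\<close>. The net effect is the clockwise rotation of the velocity at rate
      \<open>b r\<close> that Newton's equation demands.\<close>
    have Dg': "((\<lambda>t. g (\<rho> t)) has_real_derivative h r * (b r + h r / r)) (at t)"
      using DERIV_chain2[OF Dg[OF r(1,2), unfolded r_def] D\<rho>] gr by (simp add: r_def)
    have Dh': "((\<lambda>t. h (\<rho> t)) has_real_derivative (- b r - h r / r) * g r) (at t)"
      using DERIV_chain2[OF Dh[OF r(1,2), unfolded r_def] D\<rho>] by (simp add: r_def)
    have nq: "norm (q t) = r"
      using r by (simp add: q_def norm_polar r_def)
    then have disc: "q t \<in> unit_disc" using r by (simp add: unit_disc_def)
    have "r *\<^sub>R axis 1 1 \<in> unit_disc" "norm (q t) = norm (r *\<^sub>R (axis 1 1 :: real^2))"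
      using r nq by (auto simp: unit_disc_def)
    then have Bq: "B (q t) = b r"
      using assms(2) disc unfolding radial_on_def b_def by blast
    have Dq: "(q has_vector_derivative v t) (at t)"
      unfolding q_def v_def
      by (rule has_vector_derivative_vector2)
         (use r in \<open>auto intro!: derivative_eq_intros D\<rho> D\<theta> simp flip: r_def\<close>)
    have Dv: "(v has_vector_derivative
        vector [b r * (g r * sin (\<theta> t) + h r * cos (\<theta> t)),
                - b r * (g r * cos (\<theta> t) - h r * sin (\<theta> t))]) (at t)"
      unfolding v_def
    proof (rule has_vector_derivative_vector2)
      show "((\<lambda>t. g (\<rho> t) * cos (\<theta> t) - h (\<rho> t) * sin (\<theta> t)) has_real_derivative
          b r * (g r * sin (\<theta> t) + h r * cos (\<theta> t))) (at t)"
        using r by (auto intro!: derivative_eq_intros Dg' Dh' D\<theta> simp: field_simps simp flip: r_def)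
      show "((\<lambda>t. g (\<rho> t) * sin (\<theta> t) + h (\<rho> t) * cos (\<theta> t)) has_real_derivative
          - b r * (g r * cos (\<theta> t) - h r * sin (\<theta> t))) (at t)"
        using r by (auto intro!: derivative_eq_intros Dg' Dh' D\<theta> simp: field_simps simp flip: r_def)
    qed
    have "B (q t) *\<^sub>R vector [v t $ 2, - (v t $ 1)] =
        (vector [b r * (g r * sin (\<theta> t) + h r * cos (\<theta> t)),
                - b r * (g r * cos (\<theta> t) - h r * sin (\<theta> t))] :: real^2)"
      unfolding Bq by (simp add: v_def vec_eq_iff forall_2 r_def algebra_simps)
    with Dq Dv disc show ?thesis
      by (auto intro: has_vector_derivative_at_within)
  qed
  have "magnetic_trajectory B {0..<T} q"
    unfolding magnetic_trajectory_def using motion by (auto intro!: exI[of _ v])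
  moreover have "((\<lambda>t. norm (q t)) \<longlongrightarrow> 1) (at_left T)"
    using tendsto_rabs[OF lim] by (simp add: q_def norm_polar)
  ultimately show ?thesis
    using T unfolding reaches_boundary_at_def by blast
qed

end
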